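(* Let $c>1$ be a constant. Given a set $P$ of $n$ points in $d$-dimensional Hamming space $\{0,1\}^d$, a positive integer $k\le n$ and block size $B$, there exists an indexing scheme using $O(n^{O(1)}d\lceil k/B\rceil)$ blocks of space such that for every query $q\in\{0,1\}^d$, some $\lceil k/B\rceil$ blocks together contain $k$ points of $P$ each at Hamming distance at most $c$ times the distance from $q$ to its $k$-th nearest neighbor in $P$.
   Context: Indexing scheme (indexability model): for a point set $P$ and block size $B$, a collection $\mathcal{B}$ of blocks, each a subset of $P$ of at most $B$ points; its space usage is $|\mathcal{B}|$; the query time for a query $q$ is the minimum number of blocks whose union contains a valid answer, the blocks being identified for free. *)

theory Defs
  imports Complex_Main "HOL-Library.Multiset"
begin

definition hamming_space :: "nat \<Rightarrow> bool list set" where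
  "hamming_space d = {x. length x = d}"

definition hamming_dist :: "bool list \<Rightarrow> bool list \<Rightarrow> nat" where
  "hamming_dist x y = card {i. i < length x \<and> x ! i \<noteq> y ! i}"

text \<open>The distances from \<open>q\<close> to the points of \<open>P\<close> are sorted with multiplicity,
  so ties between equidistant points are counted; meaningful for \<open>1 \<le> k \<le> card P\<close>.\<close>

definition kth_nn_dist :: "bool list set \<Rightarrow> nat \<Rightarrow> bool list \<Rightarrow> nat" where
  "kth_nn_dist P k q =
     sorted_list_of_multiset (image_mset (hamming_dist q) (mset_set P)) ! (k - 1)"

definition approx_knn_answer ::
    "real \<Rightarrow> bool list set \<Rightarrow> nat \<Rightarrow> bool list \<Rightarrow> bool list set \<Rightarrow> bool" where
  "approx_knn_answer c P k q A \<longleftrightarrow>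
     A \<subseteq> P \<and> card A = k \<and>
     (\<forall>p\<in>A. real (hamming_dist q p) \<le> c * real (kth_nn_dist P k q))"

definition indexing_scheme :: "'a set \<Rightarrow> nat \<Rightarrow> 'a set set \<Rightarrow> bool" where
  "indexing_scheme P B \<B> \<longleftrightarrow>
     finite \<B> \<and> (\<forall>b\<in>\<B>. b \<subseteq> P \<and> finite b \<and> card b \<le> B)"

end

theory Submission imports Defs begin

text \<open>
  Fix a query \<open>q\<close>, let \<open>r\<close> be its \<open>k\<close>-th nearest neighbor distance and let \<open>p\<close> be a point of
  \<open>P\<close> within distance \<open>r\<close> of \<open>q\<close>. Regarding points as real vectors, we have
  \<open>dist q x = |q - p|\<^sup>2 + |x - p|\<^sup>2 - 2 \<langle>q - p, x - p\<rangle>\<close>, so the points within distance \<open>2 r\<close> of \<open>p\<close>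
  are ranked up to an error \<open>O(\<delta> r)\<close> by any vector \<open>g\<close> whose inner products with the \<open>x - p\<close> agree
  with those of \<open>q - p\<close> up to \<open>\<delta> r\<close>. Such a \<open>g\<close> is found greedily: as long as some \<open>x - p\<close>
  witnesses a larger error, add \<open>\<plusminus>(\<delta>/2) (x - p)\<close> to \<open>g\<close>. Each step lowers \<open>|q - p - g|\<^sup>2 \<le> r\<close> by at
  least \<open>\<delta>\<^sup>2 r / 2\<close>, so there are at most \<open>2 / \<delta>\<^sup>2\<close> steps. Hence \<open>g\<close>, and with it a valid
  answer, is determined by a bounded number of points of \<open>P\<close>, and polynomially many answers
  suffice for all queries.
\<close>

section \<open>Greedy approximation of inner products\<close>

text \<open>Each correction lowers the squared norm of \<open>u\<close> by at least
  \<open>\<gamma>\<close>, so a squared norm of at most \<open>m * \<gamma>\<close> pays for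
  \<open>m\<close> corrections. The residual is zero once this budget is spent.\<close>

lemma greedy_inner_product_approximation:
  fixes u :: "'i \<Rightarrow> real" and V :: "'a \<Rightarrow> 'i \<Rightarrow> real"
  assumes I: "finite I" and V: "\<And>x. x \<in> X \<Longrightarrow> (\<Sum>i\<in>I. (V x i)\<^sup>2) \<le> s"
    and \<eta>: "\<eta> > 0" and \<theta>: "\<theta> \<ge> 0" and \<gamma>: "\<gamma> \<le> 2 * \<eta> * \<theta> - \<eta>\<^sup>2 * s"
    and u: "(\<Sum>i\<in>I. (u i)\<^sup>2) \<le> real m * \<gamma>"
  shows "\<exists>w. set w \<subseteq> X \<times> {-\<eta>, \<eta>} \<and> length w \<le> m \<and>
    (\<forall>x\<in>X. \<bar>\<Sum>i\<in>I. (u i - (\<Sum>(y, t)\<leftarrow>w. t * V y i)) * V x i\<bar> \<le> \<theta>)"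
  using u
proof (induction m arbitrary: u)
  case 0
  then have "(\<Sum>i\<in>I. (u i)\<^sup>2) = 0"
    by (simp add: order_antisym sum_nonneg)
  then have "\<forall>i\<in>I. u i = 0"
    using I by (simp add: sum_nonneg_eq_0_iff)
  then show ?case
    using \<theta> by (intro exI[of _ "[]"]) simp
next
  case (Suc m)
  show ?case
  proof (cases "\<forall>x\<in>X. \<bar>\<Sum>i\<in>I. u i * V x i\<bar> \<le> \<theta>")
    case True
    then show ?thesis
      by (intro exI[of _ "[]"]) simp
  next
    case False
    then obtain x where x: "x \<in> X" and large: "\<bar>\<Sum>i\<in>I. u i * V x i\<bar> > \<theta>"
      by force
    \<comment> \<open>The sign of \<open>t\<close> is that of the inner product, so the cross term
      gains its absolute value.\<close>
    define t where "t = (if (\<Sum>i\<in>I. u i * V x i) > 0 then \<eta> else -\<eta>)"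
    define u' where "u' i = u i - t * V x i" for i
    have t: "t \<in> {-\<eta>, \<eta>}" "t\<^sup>2 = \<eta>\<^sup>2"
      by (auto simp: t_def)
    have "t * (\<Sum>i\<in>I. u i * V x i) = \<eta> * \<bar>\<Sum>i\<in>I. u i * V x i\<bar>"
      by (simp add: t_def)
    also have "\<dots> \<ge> \<eta> * \<theta>"
      using large \<eta> by simp
    finally have gain: "t * (\<Sum>i\<in>I. u i * V x i) \<ge> \<eta> * \<theta>" .
    have "(\<Sum>i\<in>I. (u' i)\<^sup>2)
        = (\<Sum>i\<in>I. (u i)\<^sup>2) - 2 * (t * (\<Sum>i\<in>I. u i * V x i)) + t\<^sup>2 * (\<Sum>i\<in>I. (V x i)\<^sup>2)"
      by (simp add: u'_def power2_eq_square algebra_simps sum.distrib sum_subtractf sum_distrib_left)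
    also have "t\<^sup>2 * (\<Sum>i\<in>I. (V x i)\<^sup>2) \<le> \<eta>\<^sup>2 * s"
      using V[OF x] t(2) by (simp add: mult_left_mono)
    finally have "(\<Sum>i\<in>I. (u' i)\<^sup>2) \<le> real m * \<gamma>"
      using gain \<gamma> Suc.prems by (simp add: algebra_simps)
    from Suc.IH[OF this] obtain w where w: "set w \<subseteq> X \<times> {-\<eta>, \<eta>}" "length w \<le> m"
      "\<forall>x\<in>X. \<bar>\<Sum>i\<in>I. (u' i - (\<Sum>(y, t)\<leftarrow>w. t * V y i)) * V x i\<bar> \<le> \<theta>"
      by blast
    show ?thesis
      using w x t(1)
      by (intro exI[of _ "(x, t) # w"]) (auto simp: u'_def diff_diff_eq)
  qed
qed

section \<open>Splitting an answer into blocks\<close>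

text \<open>The number of blocks must be exactly \<open>m\<close>, so blocks are peeled off
  nonempty: being disjoint from the rest, they are then distinct.\<close>

lemma partition_into_small_blocks:
  assumes "finite A" "m \<le> card A" "card A \<le> m * B" "1 \<le> B"
  shows "\<exists>S. finite S \<and> card S = m \<and> \<Union>S = A \<and> (\<forall>b\<in>S. card b \<le> B)"
  using assms
proof (induction m arbitrary: A)
  case 0
  then show ?case
    by (intro exI[of _ "{}"]) auto
next
  case (Suc m)
  \<comment> \<open>At least one element is left for the new block, and at most \<open>m * B\<close>
    go to the other \<open>m\<close> blocks.\<close>
  define l where "l = min (card A - 1) (m * B)"
  have l: "m \<le> l" "l \<le> m * B" "l < card A" "card A - l \<le> B"
    using Suc.prems by (auto simp: l_def min_def)
  obtain A' where A': "A' \<subseteq> A" "card A' = l" "finite A'"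
    using obtain_subset_with_card_n[of l A] l(3) by (metis less_imp_le)
  then obtain S where S: "finite S" "card S = m" "\<Union>S = A'" "\<forall>b\<in>S. card b \<le> B"
    using Suc.IH[of A'] l Suc.prems(4) by auto
  have card: "card (A - A') = card A - l"
    using A' by (simp add: card_Diff_subset)
  then have "A - A' \<noteq> {}"
    using l(3) by (metis card.empty zero_less_diff less_irrefl)
  then have "A - A' \<notin> S"
    using S(3) by auto
  then show ?case
    using S A'(1) card l(4) by (intro exI[of _ "insert (A - A') S"]) auto
qed

section \<open>Hamming distance and nearest neighbors\<close>

lemma hamming_dist_eq_sum:
  assumes "length x = d"
  shows "real (hamming_dist x y) = (\<Sum>i<d. (of_bool (x ! i) - of_bool (y ! i))\<^sup>2)"
proof -
  have "(\<Sum>i<d. (of_bool (x ! i) - of_bool (y ! i))\<^sup>2)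
      = (\<Sum>i<d. if x ! i \<noteq> y ! i then 1 else 0 :: real)"
    by (intro sum.cong) auto
  also have "\<dots> = real (card {i\<in>{..<d}. x ! i \<noteq> y ! i})"
    by (simp flip: sum.inter_filter)
  finally show ?thesis
    using assms by (simp add: hamming_dist_def)
qed

lemma hamming_dist_commute: "length x = length y \<Longrightarrow> hamming_dist x y = hamming_dist y x"
  by (simp add: hamming_dist_def eq_commute)

lemma hamming_dist_triangle:
  assumes "length x = length y"
  shows "hamming_dist x z \<le> hamming_dist x y + hamming_dist y z"
proof -
  have "{i. i < length x \<and> x ! i \<noteq> z ! i}
      \<subseteq> {i. i < length x \<and> x ! i \<noteq> y ! i} \<union> {i. i < length y \<and> y ! i \<noteq> z ! i}"
    using assms by auto
  then show ?thesis
    unfolding hamming_dist_def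
    by (intro order_trans[OF card_mono card_Un_le]) auto
qed

lemma finite_attains_max:
  fixes f :: "'a \<Rightarrow> 'b::linorder"
  assumes "finite N" "N \<noteq> {}"
  obtains y where "y \<in> N" "\<forall>x\<in>N. f x \<le> f y"
proof -
  have "Max (f ` N) \<in> f ` N"
    using assms by (intro Max_in) auto
  then obtain y where "y \<in> N" "f y = Max (f ` N)"
    by auto
  then show thesis
    using that[of y] assms by simp
qed

text \<open>The first \<open>k\<close> entries of the sorted list are at most the entry at index
  \<open>k - 1\<close>. Counting entries in the multiset transfers this to points, ties
  included.\<close>

lemma kth_nn_dist_obtain:
  assumes "finite P" "1 \<le> k" "k \<le> card P"
  obtains N where "N \<subseteq> P" "card N = k" "\<forall>x\<in>N. hamming_dist q x \<le> kth_nn_dist P k q"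
proof -
  define M where "M = image_mset (hamming_dist q) (mset_set P)"
  define xs where "xs = sorted_list_of_multiset M"
  define r where "r = kth_nn_dist P k q"
  have xs: "sorted xs" "mset xs = M"
    by (simp_all add: xs_def)
  have len: "length xs = card P"
    using xs(2) by (metis M_def size_image_mset size_mset size_mset_set)
  have r: "r = xs ! (k - 1)"
    by (simp add: r_def kth_nn_dist_def xs_def M_def)
  have "x \<le> r" if x: "x \<in> set (take k xs)" for x
  proof -
    obtain j where "j < k" "j < length xs" "x = xs ! j"
      using x by (auto simp: in_set_conv_nth)
    then show ?thesis
      using r xs(1) assms len by (auto intro!: sorted_nth_mono)
  qed
  then have "filter (\<lambda>x. x \<le> r) (take k xs) = take k xs"
    by (simp add: filter_id_conv)
  then have "k \<le> length (filter (\<lambda>x. x \<le> r) xs)"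
    using assms len
    by (metis append_take_drop_id filter_append le_add1 length_append length_take min.absorb2)
  also have "\<dots> = size (filter_mset (\<lambda>x. x \<le> r) M)"
    by (metis mset_filter size_mset xs(2))
  also have "\<dots> = card {x\<in>P. hamming_dist q x \<le> r}"
    using assms by (simp add: M_def filter_mset_image_mset)
  finally obtain N where "N \<subseteq> {x\<in>P. hamming_dist q x \<le> r}" "card N = k"
    by (rule obtain_subset_with_card_n)
  then show thesis
    using that by (auto simp: r_def)
qed

section \<open>Ranking by approximate distances\<close>

text \<open>
  The ranking function for base point \<open>p\<close>, where the list \<open>w\<close> of points and coefficients encodes the
  vector \<open>g = \<Sum>(y, t)\<leftarrow>w. t (y - p)\<close> that stands in for \<open>q - p\<close>. The summand \<open>|q - p|\<^sup>2\<close> is the same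
  for all \<open>x\<close> and is left out.
\<close>

definition score :: "nat \<Rightarrow> bool list \<Rightarrow> (bool list \<times> real) list \<Rightarrow> bool list \<Rightarrow> real" where
  "score d p w x = real (hamming_dist p x) -
     2 * (\<Sum>i<d. (\<Sum>(y, t)\<leftarrow>w. t * (of_bool (y ! i) - of_bool (p ! i))) *
             (of_bool (x ! i) - of_bool (p ! i)))"

text \<open>Up to a term independent of \<open>x\<close>, the ranking error is twice the inner
  product that the greedy lemma bounds.\<close>

lemma hamming_dist_minus_score:
  assumes "length q = d" "length p = d"
  shows "real (hamming_dist q x) - score d p w x = real (hamming_dist q p) -
    2 * (\<Sum>i<d. (of_bool (q ! i) - of_bool (p ! i) -
             (\<Sum>(y, t)\<leftarrow>w. t * (of_bool (y ! i) - of_bool (p ! i)))) *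
           (of_bool (x ! i) - of_bool (p ! i)))"
  unfolding score_def hamming_dist_eq_sum[OF assms(1)] hamming_dist_eq_sum[OF assms(2)]
    sum_distrib_left sum_subtractf[symmetric]
  by (intro sum.cong) (simp_all add: power2_eq_square algebra_simps)

text \<open>Both thresholds, the radius around \<open>p\<close> and the score, are given by points
  \<open>y\<close> and \<open>z\<close>, which keeps the number of parameter tuples
  polynomial.\<close>

definition candidates ::
    "bool list set \<Rightarrow> nat \<Rightarrow> bool list \<times> bool list \<times> bool list \<times> (bool list \<times> real) list
      \<Rightarrow> bool list set" where
  "candidates P d = (\<lambda>(p, y, z, w).
     {x\<in>P. hamming_dist p x \<le> hamming_dist p y \<and> score d p w x \<le> score d p w z})"

lemma exists_candidates:
  assumes c: "c > 1" and m: "real m \<ge> 32 / (c - 1)\<^sup>2"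
    and P: "P \<subseteq> hamming_space d" "finite P" and k: "1 \<le> k" "k \<le> card P"
    and q: "q \<in> hamming_space d"
  shows "\<exists>p\<in>P. \<exists>y\<in>P. \<exists>z\<in>P. \<exists>w. set w \<subseteq> P \<times> {-((c - 1) / 8), (c - 1) / 8} \<and> length w \<le> m \<and>
    k \<le> card (candidates P d (p, y, z, w)) \<and>
    (\<forall>x\<in>candidates P d (p, y, z, w). real (hamming_dist q x) \<le> c * real (kth_nn_dist P k q))"
proof -
  define r where "r = real (kth_nn_dist P k q)"
  \<comment> \<open>Comparing two scores costs twice the error \<open>2 * \<delta> * r\<close>, in
    total \<open>(c - 1) * r\<close>.\<close>
  define \<delta> where "\<delta> = (c - 1) / 4"
  have \<delta>: "\<delta> > 0" and r: "r \<ge> 0"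
    using c by (auto simp: \<delta>_def r_def)
  obtain N where N: "N \<subseteq> P" "card N = k" and "\<forall>x\<in>N. hamming_dist q x \<le> kth_nn_dist P k q"
    using kth_nn_dist_obtain[OF P(2) k] by metis
  then have near: "real (hamming_dist q x) \<le> r" if "x \<in> N" for x
    using that by (simp add: r_def)
  have finN: "finite N" and "N \<noteq> {}"
    using N P k by (auto intro: finite_subset)
  then obtain p where p: "p \<in> N"
    by auto
  have len: "length x = d" if "x \<in> P" for x
    using that P by (auto simp: hamming_space_def)
  have lq: "length q = d" and lp: "length p = d"
    using q p N len by (auto simp: hamming_space_def)
  obtain y where y: "y \<in> N" "\<forall>x\<in>N. hamming_dist p x \<le> hamming_dist p y"
    using finite_attains_max[OF finN \<open>N \<noteq> {}\<close>] by metis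
  \<comment> \<open>Both \<open>p\<close> and \<open>y\<close> are within \<open>r\<close> of
    \<open>q\<close>, which yields the norm bound \<open>s = 2 * r\<close> for the greedy
    lemma.\<close>
  have "hamming_dist p y \<le> hamming_dist p q + hamming_dist q y"
    using lp lq by (intro hamming_dist_triangle) simp
  then have py: "real (hamming_dist p y) \<le> 2 * r"
    using near[OF p] near[OF y(1)] hamming_dist_commute[of p q] lp lq by simp
  define X where "X = {x\<in>P. hamming_dist p x \<le> hamming_dist p y}"
  define v :: "bool list \<Rightarrow> nat \<Rightarrow> real" where "v x i = of_bool (x ! i) - of_bool (p ! i)" for x i
  have v: "(\<Sum>i<d. (v x i)\<^sup>2) = real (hamming_dist x p)" if "length x = d" for x
    using that by (simp add: v_def hamming_dist_eq_sum)
  have "(\<Sum>i<d. (v x i)\<^sup>2) \<le> 2 * r" if "x \<in> X" for x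
    using that v[of x] len[of x] py lp hamming_dist_commute[of x p] by (auto simp: X_def)
  moreover have "r \<le> real m * (\<delta>\<^sup>2 * r / 2)"
  proof -
    \<comment> \<open>The bound on \<open>m\<close> reads
      \<open>m \<ge> 2 / \<delta>\<^sup>2\<close>. The factor \<open>r\<close>, possibly 0, is
      multiplied in afterwards.\<close>
    have "1 \<le> real m * (\<delta>\<^sup>2 / 2)"
      using m c by (simp add: \<delta>_def field_simps)
    then show ?thesis
      using mult_right_mono[OF _ r] by fastforce
  qed
  then have "(\<Sum>i<d. (v q i)\<^sup>2) \<le> real m * (\<delta>\<^sup>2 * r / 2)"
    using v[OF lq] near[OF p] by simp
  \<comment> \<open>With \<open>\<eta> = \<delta> / 2\<close> and
    \<open>\<theta> = \<delta> * r\<close>, the gain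
    \<open>2 * \<eta> * \<theta> - \<eta>\<^sup>2 * s\<close> equals
    \<open>\<delta>\<^sup>2 * r / 2\<close>.\<close>
  ultimately obtain w where w: "set w \<subseteq> X \<times> {-(\<delta> / 2), \<delta> / 2}" "length w \<le> m"
    "\<forall>x\<in>X. \<bar>\<Sum>i<d. (v q i - (\<Sum>(y, t)\<leftarrow>w. t * v y i)) * v x i\<bar> \<le> \<delta> * r"
    using greedy_inner_product_approximation
      [of "{..<d}" X v "2 * r" "\<delta> / 2" "\<delta> * r" "\<delta>\<^sup>2 * r / 2" "v q" m] \<delta> r
    by (auto simp: power2_eq_square)
  have err: "\<bar>real (hamming_dist q x) - score d p w x - real (hamming_dist q p)\<bar> \<le> 2 * (\<delta> * r)"
    if "x \<in> X" for x
    using w(3) that unfolding hamming_dist_minus_score[OF lq lp] v_def by auto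
  obtain z where z: "z \<in> N" "\<forall>x\<in>N. score d p w x \<le> score d p w z"
    using finite_attains_max[OF finN \<open>N \<noteq> {}\<close>] by metis
  have NX: "N \<subseteq> X"
    using N y by (auto simp: X_def)
  have cand: "candidates P d (p, y, z, w) = {x\<in>X. score d p w x \<le> score d p w z}"
    by (auto simp: candidates_def X_def)
  have "N \<subseteq> candidates P d (p, y, z, w)"
    using NX z by (auto simp: cand)
  moreover have "finite (candidates P d (p, y, z, w))"
    using P by (auto simp: candidates_def)
  ultimately have "k \<le> card (candidates P d (p, y, z, w))"
    using N(2) card_mono by blast
  moreover have "real (hamming_dist q x) \<le> c * r" if "x \<in> candidates P d (p, y, z, w)" for x
  proof -
    have "x \<in> X" "score d p w x \<le> score d p w z"
      using that by (auto simp: cand)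
    moreover have "z \<in> X"
      using z NX by auto
    ultimately have "real (hamming_dist q x) \<le> r + 4 * (\<delta> * r)"
      using err[of x] err[of z] near[OF z(1)] by linarith
    also have "\<dots> = c * r"
      by (simp add: \<delta>_def field_simps)
    finally show ?thesis .
  qed
  moreover have "set w \<subseteq> P \<times> {-((c - 1) / 8), (c - 1) / 8}"
    using w(1) by (auto simp: X_def \<delta>_def)
  ultimately show ?thesis
    using p y(1) z(1) N(1) w(2) unfolding r_def by blast
qed

section \<open>Counting the answers\<close>

lemma card_lists_length_le_bound:
  assumes "finite A" "1 \<le> card A"
  shows "card {xs. set xs \<subseteq> A \<and> length xs \<le> m} \<le> Suc m * card A ^ m"
proof -
  have "(\<Sum>i\<le>m. card A ^ i) \<le> (\<Sum>i\<le>m. card A ^ m)"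
    using assms by (intro sum_mono power_increasing) auto
  then show ?thesis
    using assms by (simp add: card_lists_length_le)
qed

lemma polynomially_many_answers:
  assumes c: "c > 1" and m: "real m \<ge> 32 / (c - 1)\<^sup>2"
    and P: "P \<subseteq> hamming_space d" "finite P" and k: "1 \<le> k" "k \<le> card P"
  shows "\<exists>\<A>. finite \<A> \<and> card \<A> \<le> Suc m * 2 ^ m * card P ^ (m + 3) \<and>
    (\<forall>A\<in>\<A>. A \<subseteq> P \<and> card A = k) \<and>
    (\<forall>q\<in>hamming_space d. \<exists>A\<in>\<A>. approx_knn_answer c P k q A)"
proof -
  define D where "D = P \<times> {-((c - 1) / 8), (c - 1) / 8}"
  define L where "L = {w. set w \<subseteq> D \<and> length w \<le> m}"
  define J where "J = P \<times> P \<times> P \<times> L"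
  define J' where "J' = {j\<in>J. k \<le> card (candidates P d j)}"
  \<comment> \<open>Any \<open>k\<close> candidates do, as all of them are close enough; queries
    sharing a tuple share the answer.\<close>
  define pick where "pick j = (SOME A. A \<subseteq> candidates P d j \<and> card A = k)" for j
  have pick: "pick j \<subseteq> candidates P d j \<and> card (pick j) = k" if "j \<in> J'" for j
  proof -
    have "\<exists>A. A \<subseteq> candidates P d j \<and> card A = k"
      using that obtain_subset_with_card_n[of k "candidates P d j"] by (auto simp: J'_def)
    then show ?thesis
      unfolding pick_def by (rule someI_ex)
  qed
  have "-((c - 1) / 8) \<noteq> (c - 1) / 8"
    using c by (simp add: field_simps)
  then have cardD: "card D = 2 * card P" and finD: "finite D"
    using P(2) by (simp_all add: D_def card_cartesian_product)
  have cardL: "card L \<le> Suc m * (2 * card P) ^ m"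
    using card_lists_length_le_bound[OF finD, of m] k unfolding cardD L_def by linarith
  have finL: "finite L"
    unfolding L_def by (rule finite_lists_length_le[OF finD])
  have finJ: "finite J"
    using finL P by (simp add: J_def)
  have "card J = card P ^ 3 * card L"
    by (simp add: J_def card_cartesian_product power3_eq_cube)
  also have "\<dots> \<le> card P ^ 3 * (Suc m * (2 * card P) ^ m)"
    using cardL by (rule mult_le_mono2)
  also have "\<dots> = Suc m * 2 ^ m * card P ^ (m + 3)"
    by (simp only: power_add power_mult_distrib mult_ac)
  finally have cardJ: "card J \<le> Suc m * 2 ^ m * card P ^ (m + 3)" .
  have "J' \<subseteq> J"
    by (auto simp: J'_def)
  then have "card (pick ` J') \<le> card J"
    using finJ by (meson card_image_le card_mono finite_subset order_trans)
  moreover have "finite (pick ` J')"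
    using finJ \<open>J' \<subseteq> J\<close> by (meson finite_imageI finite_subset)
  moreover have "candidates P d j \<subseteq> P" for j
    by (auto simp: candidates_def split: prod.splits)
  moreover have "\<exists>A\<in>pick ` J'. approx_knn_answer c P k q A" if q: "q \<in> hamming_space d" for q
  proof -
    obtain j where "j \<in> J'"
      "\<forall>x\<in>candidates P d j. real (hamming_dist q x) \<le> c * real (kth_nn_dist P k q)"
      using exists_candidates[OF c m P k q] unfolding J'_def J_def L_def D_def by blast
    then show ?thesis
      using pick[of j] \<open>candidates P d j \<subseteq> P\<close> unfolding approx_knn_answer_def by blast
  qed
  ultimately show ?thesis
    using cardJ pick by (intro exI[of _ "pick ` J'"]) fastforce
qed

section \<open>Assembling the indexing scheme\<close>

theorem theorem4:
  fixes c :: real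
  assumes "c > 1"
  shows "\<exists>(C::real) (a::nat). \<forall>(d::nat) (n::nat) (k::nat) (B::nat) (P::bool list set).
    1 \<le> d \<and> P \<subseteq> hamming_space d \<and> card P = n \<and> 1 \<le> k \<and> k \<le> n \<and> 1 \<le> B \<longrightarrow>
    (\<exists>\<B>. indexing_scheme P B \<B> \<and>
       real (card \<B>) \<le> C * (real n ^ a * real d * real_of_int \<lceil>real k / real B\<rceil>) \<and>
       (\<forall>q\<in>hamming_space d. \<exists>\<S>\<subseteq>\<B>.
          int (card \<S>) = \<lceil>real k / real B\<rceil> \<and>
          (\<exists>A. approx_knn_answer c P k q A \<and> A \<subseteq> \<Union>\<S>)))"
proof -
  \<comment> \<open>\<open>m\<close> depends on \<open>c\<close> alone, so the constant and the
    exponent are uniform in all other parameters.\<close>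
  obtain m :: nat where m: "real m \<ge> 32 / (c - 1)\<^sup>2"
    using real_arch_simple by blast
  have "\<exists>\<B>. indexing_scheme P B \<B> \<and>
       real (card \<B>) \<le> real (Suc m * 2 ^ m) *
         (real n ^ (m + 3) * real d * real_of_int \<lceil>real k / real B\<rceil>) \<and>
       (\<forall>q\<in>hamming_space d. \<exists>\<S>\<subseteq>\<B>.
          int (card \<S>) = \<lceil>real k / real B\<rceil> \<and>
          (\<exists>A. approx_knn_answer c P k q A \<and> A \<subseteq> \<Union>\<S>))"
    if d: "1 \<le> d" and P: "P \<subseteq> hamming_space d" and n: "card P = n"
      and k: "1 \<le> k" "k \<le> n" and B: "1 \<le> B"
    for d n k B :: nat and P :: "bool list set"
  proof -
    have finP: "finite P"
      using n k by (metis card.infinite not_one_le_zero order_trans)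
    obtain \<A> where \<A>: "finite \<A>" "card \<A> \<le> Suc m * 2 ^ m * n ^ (m + 3)"
      "\<forall>A\<in>\<A>. A \<subseteq> P \<and> card A = k"
      "\<forall>q\<in>hamming_space d. \<exists>A\<in>\<A>. approx_knn_answer c P k q A"
      using polynomially_many_answers[OF assms m P finP] k n by metis
    define t where "t = nat \<lceil>real k / real B\<rceil>"
    have "0 \<le> \<lceil>real k / real B\<rceil>"
      by (metis ceiling_mono ceiling_zero divide_nonneg_nonneg of_nat_0_le_iff)
    then have t: "int t = \<lceil>real k / real B\<rceil>"
      by (simp add: t_def)
    have "real k / real B \<le> real t"
      by (simp add: t_def of_nat_ceiling)
    then have "real k \<le> real (t * B)"
      using B by (simp add: field_simps)
    then have kt: "k \<le> t * B"
      by (simp only: of_nat_le_iff)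
    \<comment> \<open>This gives \<open>t \<le> k\<close>, so that \<open>k\<close> points fill
      \<open>t\<close> nonempty blocks.\<close>
    have "real k / real B \<le> real k"
      using B by (simp add: divide_le_eq mult_le_cancel_left1)
    then have tk: "t \<le> k"
      by (simp add: t_def ceiling_le_iff)
    have "\<forall>A\<in>\<A>. \<exists>S. finite S \<and> card S = t \<and> \<Union>S = A \<and> (\<forall>b\<in>S. card b \<le> B)"
      using \<A>(3) finP kt tk B by (metis finite_subset partition_into_small_blocks)
    then obtain S where S: "\<forall>A\<in>\<A>. finite (S A) \<and> card (S A) = t \<and> \<Union>(S A) = A \<and>
        (\<forall>b\<in>S A. card b \<le> B)"
      by metis
    define \<B> where "\<B> = (\<Union>A\<in>\<A>. S A)"
    have "b \<subseteq> P \<and> card b \<le> B" if "b \<in> \<B>" for b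
      using that S \<A>(3) unfolding \<B>_def by blast
    then have "indexing_scheme P B \<B>"
      using \<A>(1) S finP by (auto simp: indexing_scheme_def \<B>_def intro: finite_subset)
    moreover have "real (card \<B>) \<le> real (Suc m * 2 ^ m) *
         (real n ^ (m + 3) * real d * real_of_int \<lceil>real k / real B\<rceil>)"
    proof -
      have "card \<B> \<le> (\<Sum>A\<in>\<A>. card (S A))"
        unfolding \<B>_def by (rule card_UN_le[OF \<A>(1)])
      also have "\<dots> = card \<A> * t"
        using S by simp
      also have "\<dots> \<le> Suc m * 2 ^ m * n ^ (m + 3) * t"
        using \<A>(2) by (rule mult_le_mono1)
      also have "\<dots> \<le> Suc m * 2 ^ m * n ^ (m + 3) * t * d"
        using d by simp
      also have "\<dots> = Suc m * 2 ^ m * (n ^ (m + 3) * d * t)"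
        by (simp only: mult_ac)
      finally have "real (card \<B>) \<le> real (Suc m * 2 ^ m * (n ^ (m + 3) * d * t))"
        by (simp only: of_nat_le_iff)
      then show ?thesis
        unfolding t[symmetric] by simp
    qed
    moreover have "\<exists>\<S>\<subseteq>\<B>. int (card \<S>) = \<lceil>real k / real B\<rceil> \<and>
        (\<exists>A. approx_knn_answer c P k q A \<and> A \<subseteq> \<Union>\<S>)" if q: "q \<in> hamming_space d" for q
    proof -
      obtain A where A: "A \<in> \<A>" "approx_knn_answer c P k q A"
        using \<A>(4) q by blast
      then show ?thesis
        using S t by (intro exI[of _ "S A"]) (auto simp: \<B>_def)
    qed
    ultimately show ?thesis
      by blast
  qed
  then show ?thesis
    by (intro exI[of _ "real (Suc m * 2 ^ m)"] exI[of _ "m + 3"] allI impI) (elim conjE)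
qed

end
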